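(* Let $n\ge 1$ and let $M$ be an indecomposable $B(n)$-module. Then either there exists an $i\in[0,n-2]$ such that $M\simeq R(i)$, or there exists a string $w$ on $(Q(n),I(n))$ such that $M\simeq M(w)$.
   Context: Let $n\ge 1$ and let $\mathbb{k}$ be an algebraically closed field; $[i,j]$ denotes the integer interval $\{i,\dots,j\}$ (empty if $j<i$). The quiver $Q(n)$ has vertices $0,1,\dots,n$ and arrows $\alpha_i\colon i+1\to i$, $\beta_i\colon i\to i+1$ for $i\in[0,n-1]$. Paths are written right to left ($\gamma\delta$ means first $\delta$, then $\gamma$). $I(n)$ is the ideal of $\mathbb{k}Q(n)$ generated by $\beta_i\alpha_i-\alpha_{i+1}\beta_{i+1}$, $\alpha_i\alpha_{i+1}$, $\beta_{i+1}\beta_i$ for $i\in[0,n-2]$, together with $\alpha_0\beta_0$. Put $B(n)=\mathbb{k}Q(n)/I(n)$. A $B(n)$-module means a finite-dimensional one, identified with a representation of $Q(n)$ satisfying the relations in $I(n)$: spaces $M_i$ and linear maps $M_\gamma\colon M_i\to M_j$ for each arrow $\gamma\colon i\to j$. Walks and strings: for each arrow $\gamma$ let $\gamma^*$ be its formal inverse, with $s(\gamma^* )=t(\gamma)$, $t(\gamma^* )=s(\gamma)$, $(\gamma^* )^*=\gamma$. A walk of length $m\ge1$ is a sequence $w=\gamma_m\cdots\gamma_1$ of arrows and formal inverses with $s(\gamma_{k+1})=t(\gamma_k)$; there is also a trivial walk $\epsilon_i$ of length $0$ at each vertex $i$. A walk is a path if all its letters are arrows, and is reduced if it has length $0$ or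 $\gamma_{k+1}\ne\gamma_k^*$ for all $k$. Put $w^*=\gamma_1^*\cdots\gamma_m^*$. A walk contains a non-trivial path $p$ if $p$ or $p^*$ is a consecutive subword of it. A string on $(Q(n),I(n))$ is a reduced walk containing no non-trivial path that is a monomial appearing as a summand of one of the listed generators of $I(n)$. String modules: for a string $w=\gamma_m\cdots\gamma_1$ of length $m\geq 1$ let $f_w\colon[0,m]\to[0,n]$, $f_w(0)=s(\gamma_1)$, $f_w(j)=t(\gamma_j)$ for $j\ge1$; for $w=\epsilon_i$ put $m=0$ and $f_w(0)=i$. The representation $M(w)$ has $M(w)_j=\bigoplus_{h\in f_w^{-1}(j)}\mathbb{k}$, i.e. a basis $e_0,\dots,e_m$ with $e_h$ placed at vertex $f_w(h)$. An arrow $\delta$ acts as follows: for each $k$ with $\gamma_k=\delta$ it sends $e_{k-1}\mapsto e_k$, for each $k$ with $\gamma_k=\delta^*$ it sends $e_k\mapsto e_{k-1}$, and it sends all remaining basis vectors at its source to $0$. Modules $R(i)$, for $n\ge2$ and $i\in[0,n-2]$: $R(i)_j=\mathbb{k}$ for $j\in\{i,i+2\}$, $R(i)_{i+1}=\mathbb{k}\oplus\mathbb{k}$, and $R(i)_j=0$ otherwise. The arrows $\alpha_i$ and $\beta_{i+1}$ act by the matrix $[\,1\ \ 0\,]$, the arrows $\beta_i$ and $\alpha_{i+1}$ act by the column $\begin{bmatrix}0\\1\end{bmatrix}$, and all other arrows act by $0$. *)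

theory Defs
  imports
    "HOL-Computational_Algebra.Polynomial"
    "HOL-Library.Function_Algebras"
    "HOL-Library.Sublist"
begin

section \<open>The quiver and its relations\<close>

text \<open>
  \<open>Alpha i\<close> is the arrow from \<open>i + 1\<close> to \<open>i\<close>, and \<open>Beta i\<close> the arrow from \<open>i\<close> to \<open>i + 1\<close>.
  The vertices of the quiver are the naturals up to \<open>n\<close>.
\<close>

datatype arrow = Alpha nat | Beta nat

fun arrow_src :: "arrow \<Rightarrow> nat" where
  "arrow_src (Alpha i) = Suc i"
| "arrow_src (Beta i) = i"

fun arrow_tgt :: "arrow \<Rightarrow> nat" where
  "arrow_tgt (Alpha i) = i"
| "arrow_tgt (Beta i) = Suc i"

definition arrows :: "nat \<Rightarrow> arrow set" where
  "arrows n = Alpha ` {..<n} \<union> Beta ` {..<n}"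

text \<open>
  Paths and walks are lists in order of traversal, so the path written right to left as
  \<open>\<gamma>\<^sub>m \<cdots> \<gamma>\<^sub>1\<close> is the list \<open>[\<gamma>\<^sub>1, \<dots>, \<gamma>\<^sub>m]\<close>; for instance \<open>\<beta>\<^sub>i \<alpha>\<^sub>i\<close> is \<open>[Alpha i, Beta i]\<close>.

  A generator of the ideal is a pair of a vertex, the common source of the paths involved, and
  a linear combination given by its summands (coefficient, path).
\<close>

type_synonym path = "arrow list"

definition generators :: "nat \<Rightarrow> (nat \<times> (int \<times> path) list) set" where
  "generators n =
     {(i + 1, [(1, [Alpha i, Beta i]), (- 1, [Beta (i + 1), Alpha (i + 1)])]) | i. i + 2 \<le> n} \<union>
     {(i + 2, [(1, [Alpha (i + 1), Alpha i])]) | i. i + 2 \<le> n} \<union>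
     {(i, [(1, [Beta i, Beta (i + 1)])]) | i. i + 2 \<le> n} \<union>
     {(0, [(1, [Beta 0, Alpha 0])])}"

definition generator_monomials :: "nat \<Rightarrow> path set" where
  "generator_monomials n = {p. \<exists>v r c. (v, r) \<in> generators n \<and> (c, p) \<in> set r}"


section \<open>Modules as representations\<close>

text \<open>
  The vertex spaces of a representation are subspaces of one ambient vector space, namely the
  type \<open>'v\<close> with scalar multiplication \<open>scale\<close>. They may overlap: they form a family, not an
  internal direct sum. Only vertices up to \<open>n\<close>, arrows in \<open>arrows n\<close>, and the values of
  the structure maps on the vertex spaces are relevant.
\<close>

record 'v rep =
  rep_space :: "nat \<Rightarrow> 'v set"
  rep_map :: "arrow \<Rightarrow> 'v \<Rightarrow> 'v"

definition linear_on_subspace ::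
  "('k::field \<Rightarrow> 'v::ab_group_add \<Rightarrow> 'v) \<Rightarrow> ('k \<Rightarrow> 'w::ab_group_add \<Rightarrow> 'w)
     \<Rightarrow> 'v set \<Rightarrow> ('v \<Rightarrow> 'w) \<Rightarrow> bool" where
  "linear_on_subspace scale scale' V f \<longleftrightarrow>
     (\<forall>x\<in>V. \<forall>y\<in>V. f (x + y) = f x + f y) \<and> (\<forall>c. \<forall>x\<in>V. f (scale c x) = scale' c (f x))"

definition path_map :: "'v rep \<Rightarrow> path \<Rightarrow> 'v \<Rightarrow> 'v" where
  "path_map M p = fold (rep_map M) p"

definition B_module ::
  "nat \<Rightarrow> ('k::field \<Rightarrow> 'v::ab_group_add \<Rightarrow> 'v) \<Rightarrow> 'v rep \<Rightarrow> bool" where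
  "B_module n scale M \<longleftrightarrow>
     vector_space scale \<and>
     (\<forall>j\<le>n. \<exists>X. finite X \<and> module.span scale X = rep_space M j) \<and>
     (\<forall>a\<in>arrows n.
        rep_map M a ` rep_space M (arrow_src a) \<subseteq> rep_space M (arrow_tgt a) \<and>
        linear_on_subspace scale scale (rep_space M (arrow_src a)) (rep_map M a)) \<and>
     (\<forall>(v, r)\<in>generators n. \<forall>x\<in>rep_space M v.
        (\<Sum>(c, p)\<leftarrow>r. scale (of_int c) (path_map M p x)) = 0)"

definition rep_isomorphic ::
  "nat \<Rightarrow> ('k::field \<Rightarrow> 'v::ab_group_add \<Rightarrow> 'v) \<Rightarrow> 'v rep
     \<Rightarrow> ('k \<Rightarrow> 'w::ab_group_add \<Rightarrow> 'w) \<Rightarrow> 'w rep \<Rightarrow> bool" where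
  "rep_isomorphic n scale M scale' N \<longleftrightarrow>
     (\<exists>\<phi>. (\<forall>j\<le>n. bij_betw (\<phi> j) (rep_space M j) (rep_space N j) \<and>
                   linear_on_subspace scale scale' (rep_space M j) (\<phi> j)) \<and>
          (\<forall>a\<in>arrows n. \<forall>x\<in>rep_space M (arrow_src a).
             \<phi> (arrow_tgt a) (rep_map M a x) = rep_map N a (\<phi> (arrow_src a) x)))"

definition subrep ::
  "nat \<Rightarrow> ('k::field \<Rightarrow> 'v::ab_group_add \<Rightarrow> 'v) \<Rightarrow> 'v rep \<Rightarrow> (nat \<Rightarrow> 'v set) \<Rightarrow> bool" where
  "subrep n scale M U \<longleftrightarrow>
     (\<forall>j\<le>n. module.subspace scale (U j) \<and> U j \<subseteq> rep_space M j) \<and>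
     (\<forall>a\<in>arrows n. rep_map M a ` U (arrow_src a) \<subseteq> U (arrow_tgt a))"

definition indecomposable ::
  "nat \<Rightarrow> ('k::field \<Rightarrow> 'v::ab_group_add \<Rightarrow> 'v) \<Rightarrow> 'v rep \<Rightarrow> bool" where
  "indecomposable n scale M \<longleftrightarrow>
     (\<exists>j\<le>n. rep_space M j \<noteq> {0}) \<and>
     (\<forall>U W. subrep n scale M U \<and> subrep n scale M W \<and>
        (\<forall>j\<le>n. U j \<inter> W j = {0} \<and> rep_space M j = {u + w | u w. u \<in> U j \<and> w \<in> W j}) \<longrightarrow>
        (\<forall>j\<le>n. U j = {0}) \<or> (\<forall>j\<le>n. W j = {0}))"


section \<open>Walks and strings\<close>

datatype letter = Arr arrow | Inv arrow

fun letter_inv :: "letter \<Rightarrow> letter" where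
  "letter_inv (Arr a) = Inv a"
| "letter_inv (Inv a) = Arr a"

fun letter_src :: "letter \<Rightarrow> nat" where
  "letter_src (Arr a) = arrow_src a"
| "letter_src (Inv a) = arrow_tgt a"

fun letter_tgt :: "letter \<Rightarrow> nat" where
  "letter_tgt (Arr a) = arrow_tgt a"
| "letter_tgt (Inv a) = arrow_src a"

text \<open>
  A walk is a pair of its start vertex and its list of letters. The trivial walk at \<open>i\<close> is
  \<open>(i, [])\<close>; for non-empty lists the start vertex is determined by the first letter.
\<close>

type_synonym walk = "nat \<times> letter list"

fun is_walk :: "nat \<Rightarrow> walk \<Rightarrow> bool" where
  "is_walk n (i, ls) \<longleftrightarrow>
     i \<le> n \<and> set ls \<subseteq> Arr ` arrows n \<union> Inv ` arrows n \<and>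
     (ls \<noteq> [] \<longrightarrow> letter_src (hd ls) = i) \<and>
     successively (\<lambda>x y. letter_src y = letter_tgt x) ls"

fun reduced :: "walk \<Rightarrow> bool" where
  "reduced (i, ls) \<longleftrightarrow> successively (\<lambda>x y. y \<noteq> letter_inv x) ls"

fun contains_path :: "walk \<Rightarrow> path \<Rightarrow> bool" where
  "contains_path (i, ls) p \<longleftrightarrow>
     sublist (map Arr p) ls \<or> sublist (rev (map (letter_inv \<circ> Arr) p)) ls"

definition is_string :: "nat \<Rightarrow> walk \<Rightarrow> bool" where
  "is_string n w \<longleftrightarrow>
     is_walk n w \<and> reduced w \<and> (\<forall>p\<in>generator_monomials n. \<not> contains_path w p)"


section \<open>String modules and the modules \<open>R(i)\<close>\<close>

text \<open>
  The ambient space of both families is \<open>nat \<Rightarrow> 'k\<close>: a function \<open>x\<close> is the vector with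
  \<open>x h\<close> as its coefficient at the basis vector \<open>e\<^sub>h\<close>, and \<open>coord_space S\<close> has the basis
  of all \<open>e\<^sub>h\<close> with \<open>h \<in> S\<close>.
\<close>

definition coord_scale :: "'k::field \<Rightarrow> (nat \<Rightarrow> 'k) \<Rightarrow> nat \<Rightarrow> 'k" where
  "coord_scale c x = (\<lambda>h. c * x h)"

definition coord_space :: "nat set \<Rightarrow> (nat \<Rightarrow> 'k::field) set" where
  "coord_space S = {x. \<forall>h. h \<notin> S \<longrightarrow> x h = 0}"

fun walk_vertex :: "walk \<Rightarrow> nat \<Rightarrow> nat" where
  "walk_vertex (i, ls) 0 = i"
| "walk_vertex (i, ls) (Suc j) = letter_tgt (ls ! j)"

text \<open>
  Letters are numbered from 1 in the usual notation, so \<open>\<gamma>\<^sub>k\<close> is \<open>ls ! (k - 1)\<close>. The coefficient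
  of the image at \<open>e\<^sub>h\<close> receives \<open>x (h - 1)\<close> if \<open>\<gamma>\<^sub>h\<close> is the acting arrow, and \<open>x (h + 1)\<close>
  if \<open>\<gamma>\<^bsub>h+1\<^esub>\<close> is its formal inverse.
\<close>

fun string_module :: "walk \<Rightarrow> (nat \<Rightarrow> 'k::field) rep" where
  "string_module (i, ls) =
     \<lparr> rep_space = (\<lambda>j. coord_space {h. h \<le> length ls \<and> walk_vertex (i, ls) h = j}),
       rep_map = (\<lambda>a x h.
         (if 1 \<le> h \<and> h \<le> length ls \<and> ls ! (h - 1) = Arr a then x (h - 1) else 0) +
         (if h < length ls \<and> ls ! h = Inv a then x (h + 1) else 0)) \<rparr>"

definition R_module :: "nat \<Rightarrow> (nat \<Rightarrow> 'k::field) rep" where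
  "R_module i =
     \<lparr> rep_space = (\<lambda>j. if j = i \<or> j = i + 2 then coord_space {0}
                       else if j = i + 1 then coord_space {0, 1}
                       else coord_space {}),
       rep_map = (\<lambda>a x.
         if a = Alpha i \<or> a = Beta (i + 1) then (\<lambda>h. if h = 0 then x 0 else 0)
         else if a = Beta i \<or> a = Alpha (i + 1) then (\<lambda>h. if h = 1 then x 0 else 0)
         else 0) \<rparr>"

end

theory Submission
  imports Defs
begin

text \<open>
  An indecomposable module is isomorphic to every non-zero module \<open>N\<close> that is a retract of it
  (\<open>indecomposable_iso_retract\<close>). So it suffices to split off from \<open>M\<close> one module of the
  two families. In each case the embedding \<open>\<sigma>\<close> of \<open>N\<close> is given by vectors of \<open>M\<close>, the
  retraction \<open>\<phi>\<close> by linear functionals on the vertex spaces, and the work consists in finding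
  functionals that are dual to the vectors and compatible with the arrows.

  Suppose first that a loop \<open>\<beta>\<^sub>i \<alpha>\<^sub>i\<close> acts non-trivially, say on \<open>x\<close> at the vertex \<open>i + 1\<close>. The
  projective module at \<open>i + 1\<close> is also injective, so the submodule generated by \<open>x\<close> should be a
  direct summand. Concretely, a single functional \<open>\<xi>\<close> at \<open>i + 1\<close> with \<open>\<xi> x = 0\<close> and
  \<open>\<xi> (\<beta>\<^sub>i \<alpha>\<^sub>i x) = 1\<close> defines the retraction, by composing \<open>\<xi>\<close> with the paths that end at
  \<open>i + 1\<close>. The summand is \<open>R(i)\<close> if \<open>i + 1 < n\<close> (\<open>R_module_if_inner_loop\<close>) and the string module
  of \<open>\<beta>\<^sub>i \<alpha>\<^sub>i\<close> if \<open>i + 1 = n\<close> (\<open>string_module_if_outer_loop\<close>).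

  Suppose now that all loops act by zero. Then every path of length two does, and only strings that
  alternate between arrows \<open>\<beta>\<close> and inverse arrows \<open>\<alpha>\<^sup>*\<close> are needed. Let \<open>a\<close> be the lowest vertex
  with a non-zero space, and consider the zigzag
  \<open>V\<^sub>a \<rightarrow> V\<^bsub>a+1\<^esub> \<leftarrow> V\<^bsub>a+2\<^esub> \<rightarrow> \<cdots>\<close>, or the one with all arrows reversed. A chain picks one vector
  from each space, compatibly with these maps. Going up as far as chains with a non-zero
  starting vector exist, and as long as a chain that ends in \<open>0\<close> must also start in \<open>0\<close>, one
  reaches a vertex \<open>b\<close> where a chain \<open>u\<close> spans a submodule (\<open>exists_terminal_chain\<close>). Its
  starting vector is not the start of any chain that ends in \<open>0\<close> or, if \<open>b\<close> is a sink of the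
  zigzag, in the image of \<open>V\<^bsub>b+1\<^esub>\<close>. Chains are the only obstruction to compatible functionals: on the direct sum of
  \<open>V\<^sub>a, \<dots>, V\<^sub>b\<close>, the relations that a compatible family has to respect span a subspace which meets
  the copy of \<open>V\<^sub>a\<close> exactly in the starting vectors of such chains
  (\<open>exists_compatible_functionals\<close>). Hence there are functionals with value \<open>1\<close> on \<open>u\<close>, and the
  string module of the zigzag from \<open>a\<close> to \<open>b\<close> is a summand
  (\<open>string_module_if_terminal_chain\<close>).
\<close>


section \<open>Linear functionals\<close>

lemma (in vector_space) exists_functional_separating:
  assumes T: "subspace T" and x: "x \<notin> T"
  obtains f where "Vector_Spaces.linear scale (*) f" "\<And>t. t \<in> T \<Longrightarrow> f t = 0" "f x = 1"
proof -
  interpret field: vector_space "(*) :: 'a \<Rightarrow> 'a \<Rightarrow> 'a"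
    by unfold_locales (auto simp: algebra_simps)
  interpret vector_space_pair scale "(*) :: 'a \<Rightarrow> 'a \<Rightarrow> 'a"
    by unfold_locales
  obtain B where B: "B \<subseteq> T" "independent B" "T \<subseteq> span B"
    using maximal_independent_subset by blast
  have "span B \<subseteq> T"
    using B(1) T by (rule span_minimal)
  with x have "independent (insert x B)"
    using B(2) independent_insertI by auto
  then obtain f where f: "Vector_Spaces.linear scale (*) f"
      "\<forall>b\<in>insert x B. f b = (if b = x then 1 else 0)"
    using linear_independent_extend[where f = "\<lambda>b. if b = x then 1 else 0"] by blast
  interpret f: Vector_Spaces.linear scale "(*)" f by (fact f(1))
  have "f t = 0" if "t \<in> T" for t
  proof (rule f.eq_0_on_span)
    show "t \<in> span B" using that B(3) by blast
    show "f b = 0" if "b \<in> B" for b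
      using that f(2) B(1) x by auto
  qed
  moreover have "f x = 1" using f(2) by simp
  ultimately show ?thesis using f(1) that by blast
qed


section \<open>Homomorphisms and direct summands\<close>

definition rep_hom ::
  "nat \<Rightarrow> ('k::field \<Rightarrow> 'v::ab_group_add \<Rightarrow> 'v) \<Rightarrow> 'v rep
     \<Rightarrow> ('k \<Rightarrow> 'w::ab_group_add \<Rightarrow> 'w) \<Rightarrow> 'w rep \<Rightarrow> (nat \<Rightarrow> 'v \<Rightarrow> 'w) \<Rightarrow> bool" where
  "rep_hom n scale M scale' N \<phi> \<longleftrightarrow>
     (\<forall>j\<le>n. \<phi> j ` rep_space M j \<subseteq> rep_space N j \<and>
            linear_on_subspace scale scale' (rep_space M j) (\<phi> j)) \<and>
     (\<forall>a\<in>arrows n. \<forall>x\<in>rep_space M (arrow_src a).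
        \<phi> (arrow_tgt a) (rep_map M a x) = rep_map N a (\<phi> (arrow_src a) x))"

lemma arrow_ends_le:
  assumes "a \<in> arrows n"
  shows "arrow_src a \<le> n" "arrow_tgt a \<le> n"
  using assms by (auto simp: arrows_def)

lemma rep_homI:
  assumes "\<And>j x. j \<le> n \<Longrightarrow> x \<in> rep_space M j \<Longrightarrow> \<phi> j x \<in> rep_space N j"
    and "\<And>j x y. j \<le> n \<Longrightarrow> x \<in> rep_space M j \<Longrightarrow> y \<in> rep_space M j \<Longrightarrow>
           \<phi> j (x + y) = \<phi> j x + \<phi> j y"
    and "\<And>j c x. j \<le> n \<Longrightarrow> x \<in> rep_space M j \<Longrightarrow> \<phi> j (scale c x) = scale' c (\<phi> j x)"
    and "\<And>i x. i < n \<Longrightarrow> x \<in> rep_space M (Suc i) \<Longrightarrow>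
           \<phi> i (rep_map M (Alpha i) x) = rep_map N (Alpha i) (\<phi> (Suc i) x)"
    and "\<And>i x. i < n \<Longrightarrow> x \<in> rep_space M i \<Longrightarrow>
           \<phi> (Suc i) (rep_map M (Beta i) x) = rep_map N (Beta i) (\<phi> i x)"
  shows "rep_hom n scale M scale' N \<phi>"
  using assms unfolding rep_hom_def linear_on_subspace_def arrows_def by auto

lemma B_module_arrow:
  assumes M: "B_module n scale M" and a: "a \<in> arrows n"
  shows "x \<in> rep_space M (arrow_src a) \<Longrightarrow> rep_map M a x \<in> rep_space M (arrow_tgt a)"
    and "linear_on_subspace scale scale (rep_space M (arrow_src a)) (rep_map M a)"
proof -
  have *: "rep_map M a ` rep_space M (arrow_src a) \<subseteq> rep_space M (arrow_tgt a) \<and>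
      linear_on_subspace scale scale (rep_space M (arrow_src a)) (rep_map M a)"
    using M a unfolding B_module_def by blast
  then show "x \<in> rep_space M (arrow_src a) \<Longrightarrow> rep_map M a x \<in> rep_space M (arrow_tgt a)"
    by blast
  show "linear_on_subspace scale scale (rep_space M (arrow_src a)) (rep_map M a)"
    using * by blast
qed

text \<open>
  The image of \<open>\<sigma>\<close> and the kernel of \<open>\<phi>\<close> are complementary submodules, because \<open>\<sigma> \<circ> \<phi>\<close> is an
  idempotent endomorphism. The image is not zero, so the kernel is.
\<close>

lemma indecomposable_iso_retract:
  fixes scale :: "'k::field \<Rightarrow> 'v::ab_group_add \<Rightarrow> 'v"
    and scale' :: "'k \<Rightarrow> 'w::ab_group_add \<Rightarrow> 'w"
  assumes M: "B_module n scale M" and indec: "indecomposable n scale M"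
    and vs': "vector_space scale'"
    and N: "\<And>j. j \<le> n \<Longrightarrow> module.subspace scale' (rep_space N j)"
    and \<phi>: "rep_hom n scale M scale' N \<phi>" and \<sigma>: "rep_hom n scale' N scale M \<sigma>"
    and retract: "\<And>j y. j \<le> n \<Longrightarrow> y \<in> rep_space N j \<Longrightarrow> \<phi> j (\<sigma> j y) = y"
    and nonzero: "k \<le> n" "z \<in> rep_space N k" "z \<noteq> 0"
  shows "rep_isomorphic n scale M scale' N"
proof -
  interpret vector_space scale using M by (simp add: B_module_def)
  interpret N: vector_space scale' by (fact vs')
  have subM: "subspace (rep_space M j)" if "j \<le> n" for j
    using M that unfolding B_module_def by (metis subspace_span)
  have \<phi>_in: "\<phi> j x \<in> rep_space N j" if "j \<le> n" "x \<in> rep_space M j" for j x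
    using \<phi> that by (auto simp: rep_hom_def)
  have \<phi>_arrow: "\<phi> (arrow_tgt a) (rep_map M a x) = rep_map N a (\<phi> (arrow_src a) x)"
    if "a \<in> arrows n" "x \<in> rep_space M (arrow_src a)" for a x
    using \<phi> that by (simp add: rep_hom_def)
  have \<sigma>_in: "\<sigma> j y \<in> rep_space M j" if "j \<le> n" "y \<in> rep_space N j" for j y
    using \<sigma> that by (auto simp: rep_hom_def)
  have \<phi>_add: "\<phi> j (x + y) = \<phi> j x + \<phi> j y"
    if "j \<le> n" "x \<in> rep_space M j" "y \<in> rep_space M j" for j x y
    using \<phi> that by (auto simp: rep_hom_def linear_on_subspace_def)
  have \<phi>_scale: "\<phi> j (scale c x) = scale' c (\<phi> j x)"
    if "j \<le> n" "x \<in> rep_space M j" for j c x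
    using \<phi> that by (auto simp: rep_hom_def linear_on_subspace_def)
  have \<sigma>_add: "\<sigma> j (x + y) = \<sigma> j x + \<sigma> j y"
    if "j \<le> n" "x \<in> rep_space N j" "y \<in> rep_space N j" for j x y
    using \<sigma> that by (auto simp: rep_hom_def linear_on_subspace_def)
  have \<sigma>_scale: "\<sigma> j (scale' c x) = scale c (\<sigma> j x)"
    if "j \<le> n" "x \<in> rep_space N j" for j c x
    using \<sigma> that by (auto simp: rep_hom_def linear_on_subspace_def)
  have \<phi>_0: "\<phi> j 0 = 0" if "j \<le> n" for j
    using \<phi>_scale[OF that, of 0 0] subspace_0[OF subM[OF that]] by simp
  have \<sigma>_0: "\<sigma> j 0 = 0" if "j \<le> n" for j
    using \<sigma>_scale[OF that, of 0 0] N.subspace_0[OF N[OF that]] by simp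
  have \<phi>_diff: "\<phi> j (x - y) = \<phi> j x - \<phi> j y"
    if "j \<le> n" "x \<in> rep_space M j" "y \<in> rep_space M j" for j x y
    using \<phi>_add[OF that(1), of "x - y" y] subspace_diff[OF subM] that by (simp add: algebra_simps)
  note M_in = B_module_arrow(1)[OF M]
  define U where "U j = \<sigma> j ` rep_space N j" for j
  define W where "W j = {x \<in> rep_space M j. \<phi> j x = 0}" for j
  have U: "subrep n scale M U"
    unfolding subrep_def
  proof (intro conjI allI impI ballI)
    fix j assume j: "j \<le> n"
    show "U j \<subseteq> rep_space M j" using \<sigma>_in j by (auto simp: U_def)
    show "subspace (U j)"
      unfolding subspace_def
    proof (intro conjI ballI allI)
      show "0 \<in> U j"
        unfolding U_def using \<sigma>_0[OF j] N.subspace_0[OF N[OF j]]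
        by (intro image_eqI[of _ _ 0]) simp_all
      show "x + y \<in> U j" if xy: "x \<in> U j" "y \<in> U j" for x y
      proof -
        obtain p q where "p \<in> rep_space N j" "x = \<sigma> j p" "q \<in> rep_space N j" "y = \<sigma> j q"
          using xy unfolding U_def by blast
        then show ?thesis
          unfolding U_def using \<sigma>_add[OF j] N.subspace_add[OF N[OF j]]
          by (intro image_eqI[of _ _ "p + q"]) simp_all
      qed
      show "scale c x \<in> U j" if x: "x \<in> U j" for c x
      proof -
        obtain p where "p \<in> rep_space N j" "x = \<sigma> j p"
          using x unfolding U_def by blast
        then show ?thesis
          unfolding U_def using \<sigma>_scale[OF j] N.subspace_scale[OF N[OF j]]
          by (intro image_eqI[of _ _ "scale' c p"]) simp_all
      qed
    qed
  next
    fix a assume a: "a \<in> arrows n"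
    show "rep_map M a ` U (arrow_src a) \<subseteq> U (arrow_tgt a)"
    proof (clarsimp simp: U_def)
      fix y assume y: "y \<in> rep_space N (arrow_src a)"
      have "rep_map N a y = \<phi> (arrow_tgt a) (rep_map M a (\<sigma> (arrow_src a) y))"
        using \<phi>_arrow[OF a] y \<sigma>_in retract arrow_ends_le[OF a] by simp
      then have "rep_map N a y \<in> rep_space N (arrow_tgt a)"
        using \<phi>_in M_in \<sigma>_in a y arrow_ends_le[OF a] by simp
      moreover have "rep_map M a (\<sigma> (arrow_src a) y) = \<sigma> (arrow_tgt a) (rep_map N a y)"
        using \<sigma> a y by (simp add: rep_hom_def)
      ultimately show "rep_map M a (\<sigma> (arrow_src a) y)
          \<in> \<sigma> (arrow_tgt a) ` rep_space N (arrow_tgt a)"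
        by simp
    qed
  qed
  have W: "subrep n scale M W"
    unfolding subrep_def
  proof (intro conjI allI impI ballI)
    fix j assume j: "j \<le> n"
    show "W j \<subseteq> rep_space M j" by (auto simp: W_def)
    show "subspace (W j)"
      using subM[OF j] \<phi>_0[OF j] \<phi>_add[OF j] \<phi>_scale[OF j]
      by (auto simp: W_def subspace_def)
  next
    fix a assume a: "a \<in> arrows n"
    have N0: "rep_map N a 0 = 0"
    proof -
      have "0 \<in> rep_space M (arrow_src a)"
        using subspace_0[OF subM] arrow_ends_le[OF a] by blast
      moreover have "rep_map M a 0 = 0"
        using B_module_arrow(2)[OF M a] calculation scale_zero_left
        unfolding linear_on_subspace_def by metis
      ultimately have "\<phi> (arrow_tgt a) 0 = rep_map N a (\<phi> (arrow_src a) 0)"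
        using \<phi>_arrow[OF a] by metis
      then show ?thesis using \<phi>_0 arrow_ends_le[OF a] by simp
    qed
    show "rep_map M a ` W (arrow_src a) \<subseteq> W (arrow_tgt a)"
      using \<phi>_arrow[OF a] M_in[OF a] N0 by (auto simp: W_def)
  qed
  have "U j \<inter> W j = {0} \<and> rep_space M j = {u + w | u w. u \<in> U j \<and> w \<in> W j}"
    if j: "j \<le> n" for j
  proof (intro conjI equalityI subsetI)
    fix x assume "x \<in> U j \<inter> W j"
    then show "x \<in> {0}" using retract[OF j] \<sigma>_0[OF j] by (auto simp: U_def W_def)
  next
    fix x assume "x \<in> {0 :: 'v}"
    then show "x \<in> U j \<inter> W j" using U W j by (auto simp: subrep_def subspace_0)
  next
    fix x assume x: "x \<in> rep_space M j"
    have "\<sigma> j (\<phi> j x) \<in> U j" using \<phi>_in[OF j x] by (simp add: U_def)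
    moreover have "x - \<sigma> j (\<phi> j x) \<in> W j"
      using x j \<phi>_in \<sigma>_in subspace_diff[OF subM] \<phi>_diff retract by (simp add: W_def)
    moreover have "x = \<sigma> j (\<phi> j x) + (x - \<sigma> j (\<phi> j x))" by simp
    ultimately show "x \<in> {u + w | u w. u \<in> U j \<and> w \<in> W j}"
      unfolding mem_Collect_eq by (intro exI conjI)
  next
    fix x assume "x \<in> {u + w | u w. u \<in> U j \<and> w \<in> W j}"
    then obtain u w where "x = u + w" "u \<in> U j" "w \<in> W j" by auto
    moreover from this have "u \<in> rep_space M j" "w \<in> rep_space M j"
      using U W j by (auto simp: subrep_def)
    ultimately show "x \<in> rep_space M j" using subspace_add[OF subM[OF j]] by simp
  qed
  then have "(\<forall>j\<le>n. U j = {0}) \<or> (\<forall>j\<le>n. W j = {0})"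
    using conjunct2[OF indec[unfolded indecomposable_def], rule_format, of U W] U W by simp
  moreover have "U k \<noteq> {0}"
  proof
    assume "U k = {0}"
    then have "\<sigma> k z = 0" using nonzero by (auto simp: U_def)
    then show False using retract[OF nonzero(1,2)] \<phi>_0[OF nonzero(1)] nonzero(3) by simp
  qed
  ultimately have W0: "W j = {0}" if "j \<le> n" for j
    using that nonzero(1) by blast
  have "bij_betw (\<phi> j) (rep_space M j) (rep_space N j)" if j: "j \<le> n" for j
  proof (rule bij_betwI')
    fix x y assume xy: "x \<in> rep_space M j" "y \<in> rep_space M j"
    show "\<phi> j x = \<phi> j y \<longleftrightarrow> x = y"
    proof
      assume "\<phi> j x = \<phi> j y"
      then have "x - y \<in> W j"
        using xy j subspace_diff[OF subM] \<phi>_diff by (simp add: W_def)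
      then show "x = y" using W0[OF j] by simp
    qed simp
  next
    fix y assume "y \<in> rep_space N j"
    then show "\<exists>x\<in>rep_space M j. y = \<phi> j x"
      using retract[OF j] \<sigma>_in[OF j] by metis
  qed (use \<phi>_in j in auto)
  then show ?thesis
    using \<phi> unfolding rep_isomorphic_def rep_hom_def by (intro exI[of _ \<phi>]) simp
qed

lemma vector_space_coord_scale: "vector_space coord_scale"
  by unfold_locales (auto simp: coord_scale_def fun_eq_iff algebra_simps)

lemma subspace_coord_space: "module.subspace coord_scale (coord_space S)"
proof -
  interpret vector_space coord_scale by (fact vector_space_coord_scale)
  show ?thesis by (auto simp: subspace_def coord_space_def coord_scale_def)
qed


section \<open>Zigzag words\<close>

text \<open>
  The sources of the zigzag are the even vertices if \<open>t\<close> holds and the odd vertices otherwise. At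
  a source the walk follows an arrow upwards, at any other vertex it goes up against an arrow. The
  word has \<open>m\<close> letters and starts at the vertex \<open>a\<close>.
\<close>

definition zigzag_word :: "bool \<Rightarrow> nat \<Rightarrow> nat \<Rightarrow> letter list" where
  "zigzag_word t a m =
     map (\<lambda>i. if even i = t then Arr (Beta i) else Inv (Alpha i)) [a..<a + m]"

lemma length_zigzag_word [simp]: "length (zigzag_word t a m) = m"
  by (simp add: zigzag_word_def)

lemma nth_zigzag_word [simp]:
  "h < m \<Longrightarrow> zigzag_word t a m ! h =
     (if even (a + h) = t then Arr (Beta (a + h)) else Inv (Alpha (a + h)))"
  by (simp add: zigzag_word_def)

lemma sublist_pair_nth:
  assumes "sublist [x, y] ls"
  obtains k where "Suc k < length ls" "ls ! k = x" "ls ! Suc k = y"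
proof -
  obtain ps ss where "ls = ps @ [x, y] @ ss" using assms by (auto simp: sublist_def)
  then show ?thesis using that[of "length ps"] by (simp add: nth_append)
qed

lemma successively_nthI:
  "(\<And>k. Suc k < length ls \<Longrightarrow> P (ls ! k) (ls ! Suc k)) \<Longrightarrow> successively P ls"
proof (induction ls rule: induct_list012)
  case (3 x y zs)
  have "successively P (y # zs)"
    using 3(3)[of "Suc _"] by (intro 3(2)) simp
  then show ?case using 3(3)[of 0] by simp
qed auto

lemma generator_monomial_pair:
  assumes "p \<in> generator_monomials n"
  obtains x y where "p = [x, y]"
  using assms by (auto simp: generator_monomials_def generators_def)

text \<open>
  All monomials in the relations are paths of length two, whereas the letters of a zigzag
  alternate between arrows and inverse arrows.
\<close>

lemma is_string_zigzag_word:
  assumes "a + m \<le> n"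
  shows "is_string n (a, zigzag_word t a m)"
  unfolding is_string_def
proof (intro conjI ballI)
  have "set (zigzag_word t a m) \<subseteq> Arr ` arrows n \<union> Inv ` arrows n"
    using assms by (auto simp: zigzag_word_def arrows_def)
  moreover have "letter_src (hd (zigzag_word t a m)) = a" if "zigzag_word t a m \<noteq> []"
  proof -
    have "m \<noteq> 0" using that by (auto simp: zigzag_word_def)
    then show ?thesis using hd_conv_nth[OF that] by simp
  qed
  moreover have "successively (\<lambda>x y. letter_src y = letter_tgt x) (zigzag_word t a m)"
    by (rule successively_nthI) auto
  ultimately show "is_walk n (a, zigzag_word t a m)" using assms by simp
  have "successively (\<lambda>x y. y \<noteq> letter_inv x) (zigzag_word t a m)"
    by (rule successively_nthI) auto
  then show "reduced (a, zigzag_word t a m)" by simp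
next
  fix p assume "p \<in> generator_monomials n"
  then obtain x y where p: "p = [x, y]" by (rule generator_monomial_pair)
  have "\<not> sublist [Arr x, Arr y] (zigzag_word t a m)"
  proof
    assume "sublist [Arr x, Arr y] (zigzag_word t a m)"
    then obtain k where "Suc k < m" "zigzag_word t a m ! k = Arr x"
        "zigzag_word t a m ! Suc k = Arr y"
      using sublist_pair_nth by (metis length_zigzag_word)
    then show False by (cases t) (auto split: if_split_asm)
  qed
  moreover have "\<not> sublist [Inv y, Inv x] (zigzag_word t a m)"
  proof
    assume "sublist [Inv y, Inv x] (zigzag_word t a m)"
    then obtain k where "Suc k < m" "zigzag_word t a m ! k = Inv y"
        "zigzag_word t a m ! Suc k = Inv x"
      using sublist_pair_nth by (metis length_zigzag_word)
    then show False by (cases t) (auto split: if_split_asm)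
  qed
  ultimately show "\<not> contains_path (a, zigzag_word t a m) p" by (simp add: p)
qed

text \<open>
  The only loop that is not a monomial of a relation is the one at the last vertex, since there
  is no loop on its other side to identify it with.
\<close>

lemma is_string_outer_loop:
  "is_string (Suc i) (Suc i, [Arr (Alpha i), Arr (Beta i)])"
proof -
  have "\<not> contains_path (Suc i, [Arr (Alpha i), Arr (Beta i)]) p"
    if mon: "p \<in> generator_monomials (Suc i)" for p
  proof -
    obtain x y where p: "p = [x, y]" using mon by (rule generator_monomial_pair)
    have "sublist [c, d] [Arr (Alpha i), Arr (Beta i)] \<Longrightarrow> c = Arr (Alpha i) \<and> d = Arr (Beta i)"
      for c d
      by (erule sublist_pair_nth) simp
    moreover have "[Alpha i, Beta i] \<notin> generator_monomials (Suc i)"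
      by (auto simp: generator_monomials_def generators_def)
    ultimately show ?thesis using mon by (auto simp: p)
  qed
  then show ?thesis by (auto simp: is_string_def arrows_def)
qed

lemma zigzag_module_space:
  "rep_space (string_module (a, zigzag_word t a m)) j = coord_space {h. h \<le> m \<and> a + h = j}"
proof -
  have "walk_vertex (a, zigzag_word t a m) h = a + h" if "h \<le> m" for h
    using that by (cases h) auto
  then have "{h. h \<le> m \<and> walk_vertex (a, zigzag_word t a m) h = j} = {h. h \<le> m \<and> a + h = j}"
    by auto
  then show ?thesis by simp
qed

lemma zigzag_module_map:
  "rep_map (string_module (a, zigzag_word t a m)) (Beta i) c h =
     (if 1 \<le> h \<and> h \<le> m \<and> a + h = Suc i \<and> even i = t then c (h - 1) else 0)"
  "rep_map (string_module (a, zigzag_word t a m)) (Alpha i) c h =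
     (if h < m \<and> a + h = i \<and> even i \<noteq> t then c (Suc h) else 0)"
proof -
  show "rep_map (string_module (a, zigzag_word t a m)) (Beta i) c h =
      (if 1 \<le> h \<and> h \<le> m \<and> a + h = Suc i \<and> even i = t then c (h - 1) else 0)"
    by (cases h) (auto split: if_split_asm)
  show "rep_map (string_module (a, zigzag_word t a m)) (Alpha i) c h =
      (if h < m \<and> a + h = i \<and> even i \<noteq> t then c (Suc h) else 0)"
    by (cases h) (auto split: if_split_asm)
qed


section \<open>The relations\<close>

locale B_mod =
  fixes n :: nat and scale :: "'k::field \<Rightarrow> 'v::ab_group_add \<Rightarrow> 'v" and M :: "'v rep"
  assumes B_module: "B_module n scale M"
begin

abbreviation "V \<equiv> rep_space M"
abbreviation "A i \<equiv> rep_map M (Alpha i)"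
abbreviation "B i \<equiv> rep_map M (Beta i)"

sublocale vector_space scale
  using B_module by (simp add: B_module_def)

lemma subspace_V: "j \<le> n \<Longrightarrow> subspace (V j)"
  using B_module unfolding B_module_def by (metis subspace_span)

lemma V_closed:
  assumes "j \<le> n"
  shows "0 \<in> V j" "x \<in> V j \<Longrightarrow> y \<in> V j \<Longrightarrow> x + y \<in> V j" "x \<in> V j \<Longrightarrow> scale c x \<in> V j"
  using subspace_V[OF assms] by (auto simp: subspace_def)

lemma A_linear:
  assumes "i < n"
  shows "x \<in> V (Suc i) \<Longrightarrow> A i x \<in> V i"
    and "x \<in> V (Suc i) \<Longrightarrow> y \<in> V (Suc i) \<Longrightarrow> A i (x + y) = A i x + A i y"
    and "x \<in> V (Suc i) \<Longrightarrow> A i (scale c x) = scale c (A i x)"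
  using B_module_arrow[OF B_module, of "Alpha i"] assms
  by (auto simp: arrows_def linear_on_subspace_def)

lemma B_linear:
  assumes "i < n"
  shows "x \<in> V i \<Longrightarrow> B i x \<in> V (Suc i)"
    and "x \<in> V i \<Longrightarrow> y \<in> V i \<Longrightarrow> B i (x + y) = B i x + B i y"
    and "x \<in> V i \<Longrightarrow> B i (scale c x) = scale c (B i x)"
  using B_module_arrow[OF B_module, of "Beta i"] assms
  by (auto simp: arrows_def linear_on_subspace_def)

lemma A_0: "i < n \<Longrightarrow> A i 0 = 0"
  using A_linear(3)[of i 0 0] V_closed(1)[of "Suc i"] by simp

lemma B_0: "i < n \<Longrightarrow> B i 0 = 0"
  using B_linear(3)[of i 0 0] V_closed(1)[of i] by simp

lemma relation:
  assumes "(v, r) \<in> generators n" "x \<in> V v"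
  shows "(\<Sum>(c, p)\<leftarrow>r. scale (of_int c) (path_map M p x)) = 0"
  using B_module assms unfolding B_module_def by blast

lemma A_A: "Suc i < n \<Longrightarrow> x \<in> V (Suc (Suc i)) \<Longrightarrow> A i (A (Suc i) x) = 0"
  using relation[of "i + 2" "[(1, [Alpha (i + 1), Alpha i])]" x]
  by (simp add: generators_def path_map_def)

lemma B_B: "Suc i < n \<Longrightarrow> x \<in> V i \<Longrightarrow> B (Suc i) (B i x) = 0"
  using relation[of i "[(1, [Beta i, Beta (i + 1)])]" x]
  by (simp add: generators_def path_map_def)

lemma A_B_0: "x \<in> V 0 \<Longrightarrow> A 0 (B 0 x) = 0"
  using relation[of 0 "[(1, [Beta 0, Alpha 0])]" x]
  by (simp add: generators_def path_map_def)

lemma A_B_eq_B_A: "Suc i < n \<Longrightarrow> x \<in> V (Suc i) \<Longrightarrow> A (Suc i) (B (Suc i) x) = B i (A i x)"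
  using relation[of "i + 1" "[(1, [Alpha i, Beta i]), (- 1, [Beta (i + 1), Alpha (i + 1)])]" x]
  by (simp add: generators_def path_map_def)

lemma B_A_B:
  assumes "i < n" "x \<in> V i"
  shows "B i (A i (B i x)) = 0"
proof (cases i)
  case 0
  then show ?thesis using assms A_B_0 B_0 by simp
next
  case (Suc k)
  then show ?thesis using assms A_B_eq_B_A B_B A_linear(1) by simp
qed

text \<open>
  Going back and forth along one edge three times gives zero, here and in \<open>B_A_B\<close>: the loop
  inside can be moved to the neighbouring edge, where it meets a relation, or it is the zero loop
  at the vertex \<open>0\<close>.
\<close>

lemma A_B_A:
  assumes "i < n" "x \<in> V (Suc i)"
  shows "A i (B i (A i x)) = 0"
proof (cases i)
  case 0
  then show ?thesis using assms A_B_0 A_linear(1)[of i x] by simp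
next
  case (Suc k)
  then show ?thesis using assms A_B_eq_B_A A_linear(1)[of i x] A_A B_0 by simp
qed


section \<open>Biserial and uniserial projective summands\<close>

text \<open>
  The loop is nilpotent, so \<open>x\<close> is not an eigenvector of it for a non-zero eigenvalue. Hence
  \<open>x\<close> and its image can be separated.
\<close>

lemma exists_functional_at_loop:
  assumes i: "i < n" and x: "x \<in> V (Suc i)" and nz: "B i (A i x) \<noteq> 0"
  obtains \<xi> where "Vector_Spaces.linear scale (*) \<xi>" "\<xi> x = 0" "\<xi> (B i (A i x)) = 1"
proof -
  have "B i (A i x) \<notin> span {x}"
  proof
    assume "B i (A i x) \<in> span {x}"
    then obtain c where c: "B i (A i x) = scale c x"
      by (auto simp: span_singleton)
    have "scale c (B i (A i x)) = B i (A i (scale c x))"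
      using i x A_linear B_linear by simp
    also have "\<dots> = 0"
      unfolding c[symmetric] using i x A_linear(1) B_A_B by simp
    finally have "c = 0" using nz by simp
    then show False using c nz by simp
  qed
  then obtain \<xi> where "Vector_Spaces.linear scale (*) \<xi>" "\<And>t. t \<in> span {x} \<Longrightarrow> \<xi> t = 0"
      "\<xi> (B i (A i x)) = 1"
    using exists_functional_separating[OF subspace_span] by metis
  then show ?thesis using that span_base[of x "{x}"] by simp
qed

text \<open>
  The two coordinates at the vertex \<open>i + 1\<close> of \<open>R(i)\<close> are the top and the socle. The vectors \<open>x\<close>
  and \<open>\<beta>\<^sub>i \<alpha>\<^sub>i x\<close> realise them in \<open>M\<close>. Dually, the socle coordinate is \<open>\<xi>\<close>, and the others are
  \<open>\<xi>\<close> composed with the arrows and the loop that lead to \<open>i + 1\<close>.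
\<close>

lemma R_module_if_inner_loop:
  assumes indec: "indecomposable n scale M"
    and i: "Suc i < n" and x: "x \<in> V (Suc i)" and nz: "B i (A i x) \<noteq> 0"
  shows "rep_isomorphic n scale M coord_scale (R_module i)"
proof -
  obtain \<xi> where \<xi>: "Vector_Spaces.linear scale (*) \<xi>" "\<xi> x = 0" "\<xi> (B i (A i x)) = 1"
    using exists_functional_at_loop[of i x] i x nz by auto
  interpret \<xi>: Vector_Spaces.linear scale "(*)" \<xi> by (fact \<xi>(1))
  let ?z = "B i (A i x)"
  define \<phi> :: "nat \<Rightarrow> 'v \<Rightarrow> nat \<Rightarrow> 'k" where
    "\<phi> j m h = (if j = Suc i then (if h = 0 then \<xi> (B i (A i m)) else if h = 1 then \<xi> m else 0)
       else if j = i then (if h = 0 then \<xi> (B i m) else 0)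
       else if j = Suc (Suc i) then (if h = 0 then \<xi> (A (Suc i) m) else 0) else 0)" for j m h
  define \<sigma> :: "nat \<Rightarrow> (nat \<Rightarrow> 'k) \<Rightarrow> 'v" where
    "\<sigma> j c = (if j = Suc i then scale (c 0) x + scale (c 1) ?z
       else if j = i then scale (c 0) (A i x)
       else if j = Suc (Suc i) then scale (c 0) (B (Suc i) x) else 0)" for j c
  have in_V: "A i x \<in> V i" "?z \<in> V (Suc i)" "B (Suc i) x \<in> V (Suc (Suc i))"
    using i x A_linear(1) B_linear(1) by auto
  have loops: "B i (A i ?z) = 0" "A i ?z = 0" "B (Suc i) ?z = 0"
      "A (Suc i) (B (Suc i) x) = ?z"
    using i x A_B_A[of i x] B_0 B_B in_V A_B_eq_B_A by auto
  show ?thesis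
  proof (rule indecomposable_iso_retract[OF B_module indec vector_space_coord_scale])
    show "module.subspace coord_scale (rep_space (R_module i :: (nat \<Rightarrow> 'k) rep) j)" for j
      by (simp add: R_module_def subspace_coord_space)
    show "rep_hom n scale M coord_scale (R_module i) \<phi>"
    proof (rule rep_homI)
      fix k m assume k: "k < n" and m: "m \<in> V (Suc k)"
      show "\<phi> k (A k m) = rep_map (R_module i) (Alpha k) (\<phi> (Suc k) m)"
        using k m i A_A[of i m] A_A[of "Suc i" m] B_0 A_B_eq_B_A[of i m]
        by (auto simp: R_module_def \<phi>_def fun_eq_iff)
    next
      fix k m assume k: "k < n" and m: "m \<in> V k"
      show "\<phi> (Suc k) (B k m) = rep_map (R_module i) (Beta k) (\<phi> k m)"
        using k m i B_B[of k m] B_A_B[of k m] A_B_eq_B_A[of i m]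
        by (auto simp: R_module_def \<phi>_def fun_eq_iff)
    qed (use i in \<open>auto simp: R_module_def \<phi>_def coord_space_def coord_scale_def fun_eq_iff
      A_linear B_linear \<xi>.add \<xi>.scale\<close>)
    show "rep_hom n coord_scale (R_module i) scale M \<sigma>"
    proof (rule rep_homI)
      fix k c assume "k < n" "c \<in> rep_space (R_module i :: (nat \<Rightarrow> 'k) rep) (Suc k)"
      then show "\<sigma> k (rep_map (R_module i) (Alpha k) c) = A k (\<sigma> (Suc k) c)"
        using i x in_V loops A_A A_0
        by (auto simp: R_module_def \<sigma>_def A_linear V_closed)
    next
      fix k c assume "k < n" "c \<in> rep_space (R_module i :: (nat \<Rightarrow> 'k) rep) k"
      then show "\<sigma> (Suc k) (rep_map (R_module i) (Beta k) c) = B k (\<sigma> k c)"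
        using i x in_V loops B_B B_0
        by (auto simp: R_module_def \<sigma>_def B_linear V_closed)
    qed (use i x in_V in \<open>auto simp: R_module_def \<sigma>_def coord_scale_def V_closed
      scale_right_distrib scale_left_distrib algebra_simps\<close>)
    show "\<phi> j (\<sigma> j y) = y" if "y \<in> rep_space (R_module i) j" for j y
      using that i x in_V loops \<xi>
      by (auto simp: R_module_def \<phi>_def \<sigma>_def coord_space_def fun_eq_iff A_linear B_linear
          V_closed \<xi>.add \<xi>.scale)
    show "i \<le> n" using i by simp
    show "(\<lambda>h. if h = 0 then 1 else 0) \<in> rep_space (R_module i :: (nat \<Rightarrow> 'k) rep) i"
      by (simp add: R_module_def coord_space_def)
    show "(\<lambda>h::nat. if h = 0 then 1 else 0) \<noteq> (0 :: nat \<Rightarrow> 'k)"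
      by (auto simp: fun_eq_iff)
  qed
qed

text \<open>
  The same argument at the last vertex, where only one arrow leaves: the submodule generated by
  \<open>x\<close> is uniserial.
\<close>

lemma string_module_if_outer_loop:
  assumes indec: "indecomposable n scale M"
    and n: "n = Suc i" and x: "x \<in> V n" and nz: "B i (A i x) \<noteq> 0"
  shows "rep_isomorphic n scale M coord_scale (string_module (n, [Arr (Alpha i), Arr (Beta i)]))"
proof -
  obtain \<xi> where \<xi>: "Vector_Spaces.linear scale (*) \<xi>" "\<xi> x = 0" "\<xi> (B i (A i x)) = 1"
    using exists_functional_at_loop[of i x] n x nz by auto
  interpret \<xi>: Vector_Spaces.linear scale "(*)" \<xi> by (fact \<xi>(1))
  let ?z = "B i (A i x)"
  define \<phi> :: "nat \<Rightarrow> 'v \<Rightarrow> nat \<Rightarrow> 'k" where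
    "\<phi> j m h = (if j = n then (if h = 0 then \<xi> (B i (A i m)) else if h = 2 then \<xi> m else 0)
       else if j = i then (if h = 1 then \<xi> (B i m) else 0) else 0)" for j m h
  define \<sigma> :: "nat \<Rightarrow> (nat \<Rightarrow> 'k) \<Rightarrow> 'v" where
    "\<sigma> j c = (if j = n then scale (c 0) x + scale (c 2) ?z
       else if j = i then scale (c 1) (A i x) else 0)" for j c
  have in_V: "A i x \<in> V i" "?z \<in> V (Suc i)"
    using n x A_linear(1) B_linear(1) by auto
  have loops: "B i (A i ?z) = 0" "A i ?z = 0"
    using n x A_B_A[of i x] B_0 by auto
  define N :: "(nat \<Rightarrow> 'k) rep" where
    "N = string_module (n, [Arr (Alpha i), Arr (Beta i)])"
  have vertex: "walk_vertex (n, [Arr (Alpha i), Arr (Beta i)]) h = (if h = 1 then i else n)"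
    if "h \<le> Suc (Suc 0)" for h
    using that n by (auto simp: le_Suc_eq)
  have "{h. h \<le> Suc (Suc 0) \<and> walk_vertex (n, [Arr (Alpha i), Arr (Beta i)]) h = j} =
      (if j = n then {0, 2} else if j = i then {1} else {})" for j
  proof (rule set_eqI)
    fix h :: nat
    show "h \<in> {h. h \<le> Suc (Suc 0) \<and> walk_vertex (n, [Arr (Alpha i), Arr (Beta i)]) h = j} \<longleftrightarrow>
        h \<in> (if j = n then {0, 2} else if j = i then {1} else {})"
      using vertex[of h] n by (cases "h \<le> Suc (Suc 0)") auto
  qed
  then have space: "rep_space N j = coord_space
      (if j = n then {0, 2} else if j = i then {1} else {})" for j
    unfolding N_def string_module.simps rep.simps list.size by (simp only: add_0 add_0_right add_Suc)
  have map: "rep_map N a c h = (if a = Alpha i \<and> h = 1 then c 0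
      else if a = Beta i \<and> h = 2 then c 1 else 0)" for a h and c :: "nat \<Rightarrow> 'k"
  proof -
    consider "h = 0" | "h = 1" | "h = 2" | "h > 2" by linarith
    then show ?thesis by cases (auto simp: N_def numeral_2_eq_2)
  qed
  show ?thesis
    unfolding N_def[symmetric]
  proof (rule indecomposable_iso_retract[OF B_module indec vector_space_coord_scale])
    show "module.subspace coord_scale (rep_space N j)" for j
      by (simp add: space subspace_coord_space)
    show "rep_hom n scale M coord_scale N \<phi>"
    proof (rule rep_homI)
      fix k m assume k: "k < n" and m: "m \<in> V (Suc k)"
      show "\<phi> k (A k m) = rep_map N (Alpha k) (\<phi> (Suc k) m)"
        using k m n A_A[of k m] B_0 by (auto simp: map \<phi>_def fun_eq_iff)
    next
      fix k m assume k: "k < n" and m: "m \<in> V k"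
      show "\<phi> (Suc k) (B k m) = rep_map N (Beta k) (\<phi> k m)"
        using k m n B_B[of k m] B_A_B[of k m]
        by (auto simp: map \<phi>_def fun_eq_iff)
    qed (use n in \<open>auto simp: space \<phi>_def coord_space_def coord_scale_def fun_eq_iff
      A_linear B_linear \<xi>.add \<xi>.scale\<close>)
    show "rep_hom n coord_scale N scale M \<sigma>"
    proof (rule rep_homI)
      fix k c assume "k < n" "c \<in> rep_space N (Suc k)"
      then show "\<sigma> k (rep_map N (Alpha k) c) = A k (\<sigma> (Suc k) c)"
        using n x in_V loops A_A A_0
        by (auto simp: map \<sigma>_def A_linear V_closed)
    next
      fix k c assume "k < n" "c \<in> rep_space N k"
      then show "\<sigma> (Suc k) (rep_map N (Beta k) c) = B k (\<sigma> k c)"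
        using n x in_V loops B_B B_0
        by (auto simp: map \<sigma>_def B_linear V_closed)
    qed (use n x in_V in \<open>auto simp: \<sigma>_def coord_scale_def V_closed
      scale_right_distrib scale_left_distrib algebra_simps\<close>)
    show "\<phi> j (\<sigma> j y) = y" if "y \<in> rep_space N j" for j y
      using that n x in_V loops \<xi>
      by (auto simp: space \<phi>_def \<sigma>_def coord_space_def fun_eq_iff A_linear B_linear
          V_closed \<xi>.add \<xi>.scale)
    show "i \<le> n" using n by simp
    show "(\<lambda>h. if h = 1 then 1 else 0) \<in> rep_space N i"
      using n by (simp add: space coord_space_def)
    show "(\<lambda>h::nat. if h = 1 then 1 else 0) \<noteq> (0 :: nat \<Rightarrow> 'k)"
      by (auto simp: fun_eq_iff)
  qed
qed


section \<open>Zigzag chains\<close>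

definition zigzag_step :: "bool \<Rightarrow> nat \<Rightarrow> 'v \<Rightarrow> 'v \<Rightarrow> bool" where
  "zigzag_step t i x y \<longleftrightarrow>
     x \<in> V i \<and> y \<in> V (Suc i) \<and> (if even i = t then B i x = y else A i y = x)"

text \<open>
  The condition on \<open>u a\<close> matters for \<open>b = a\<close>, when there are no steps.
\<close>

definition chain :: "bool \<Rightarrow> nat \<Rightarrow> nat \<Rightarrow> (nat \<Rightarrow> 'v) \<Rightarrow> bool" where
  "chain t a b u \<longleftrightarrow> u a \<in> V a \<and> (\<forall>i. a \<le> i \<and> i < b \<longrightarrow> zigzag_step t i (u i) (u (Suc i)))"

text \<open>
  The vectors at \<open>b\<close> on which the last functional has to vanish: if \<open>b\<close> is a sink of the zigzag
  below \<open>n\<close>, then \<open>\<alpha>\<^sub>b\<close> maps into \<open>V b\<close> from outside the string.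
\<close>

definition end_image :: "bool \<Rightarrow> nat \<Rightarrow> 'v set" where
  "end_image t b = (if b < n \<and> even b \<noteq> t then A b ` V (Suc b) else {0})"

lemma zigzag_step_0: "i < n \<Longrightarrow> zigzag_step t i 0 0"
  using V_closed(1)[of i] V_closed(1)[of "Suc i"] A_0 B_0 by (auto simp: zigzag_step_def)

lemma zigzag_step_add:
  assumes "i < n" "zigzag_step t i x y" "zigzag_step t i x' y'"
  shows "zigzag_step t i (x + x') (y + y')"
  using assms V_closed(2)[of i] V_closed(2)[of "Suc i"] A_linear(2) B_linear(2)
  by (auto simp: zigzag_step_def)

lemma zigzag_step_scale:
  assumes "i < n" "zigzag_step t i x y"
  shows "zigzag_step t i (scale c x) (scale c y)"
  using assms V_closed(3)[of i] V_closed(3)[of "Suc i"] A_linear(3) B_linear(3)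
  by (auto simp: zigzag_step_def)

lemma subspace_end_image:
  assumes "b \<le> n"
  shows "subspace (end_image t b)"
proof (cases "b < n \<and> even b \<noteq> t")
  case True
  then have b: "b < n" "Suc b \<le> n" and eq: "end_image t b = A b ` V (Suc b)"
    by (auto simp: end_image_def)
  show ?thesis
    unfolding subspace_def eq
  proof (intro conjI ballI allI)
    show "0 \<in> A b ` V (Suc b)"
      using A_0[OF b(1)] V_closed(1)[OF b(2)] by (metis imageI)
    show "x + y \<in> A b ` V (Suc b)" if "x \<in> A b ` V (Suc b)" "y \<in> A b ` V (Suc b)" for x y
      using that A_linear(2)[OF b(1), symmetric] V_closed(2)[OF b(2)] by auto
    show "scale c x \<in> A b ` V (Suc b)" if "x \<in> A b ` V (Suc b)" for c x
      using that A_linear(3)[OF b(1), symmetric] V_closed(3)[OF b(2)] by auto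
  qed
next
  case False
  then have "end_image t b = {0}" unfolding end_image_def by (rule if_not_P)
  then show ?thesis by simp
qed

lemma chain_in_V: "chain t a b u \<Longrightarrow> a \<le> i \<Longrightarrow> i \<le> b \<Longrightarrow> u i \<in> V i"
  by (cases "i = b"; cases "i = a")
    (auto simp: chain_def zigzag_step_def dest: spec[of _ i] spec[of _ "i - 1"])

lemma chain_extend:
  assumes "chain t a b u" "a \<le> b" "zigzag_step t b (u b) y"
  shows "chain t a (Suc b) (u(Suc b := y))"
  using assms by (auto simp: chain_def less_Suc_eq)

lemma chain_restrict: "chain t a (Suc b) u \<Longrightarrow> chain t a b u"
  by (auto simp: chain_def)

text \<open>
  The vertex \<open>b\<close> is the last one at which some chain has a non-zero start while every chain
  ending in \<open>0\<close> starts in \<open>0\<close>. Passing a source keeps the first property and passing a sink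
  the second, so it is clear which one is lost at \<open>b + 1\<close>. If \<open>b\<close> is a source, then the second
  is lost, and the new chain ends at \<open>b\<close> in the kernel of \<open>\<beta>\<^sub>b\<close>. If it is a sink, the first is lost:
  no chain with a non-zero start can be continued beyond \<open>b\<close>.
\<close>

lemma exists_terminal_chain:
  assumes k: "a \<le> k" "k \<le> n"
    and nonzero: "chain t a k u\<^sub>0" "u\<^sub>0 a \<noteq> 0"
    and zero: "\<forall>u. chain t a k u \<longrightarrow> u k = 0 \<longrightarrow> u a = 0"
  obtains b u where "k \<le> b" "b \<le> n" "chain t a b u" "u a \<noteq> 0"
    "b < n \<Longrightarrow> even b = t \<Longrightarrow> B b (u b) = 0"
    "\<And>w. chain t a b w \<Longrightarrow> w b \<in> end_image t b \<Longrightarrow> w a = 0"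
proof -
  define P where "P b \<longleftrightarrow> k \<le> b \<and> b \<le> n \<and> (\<exists>u. chain t a b u \<and> u a \<noteq> 0) \<and>
    (\<forall>u. chain t a b u \<longrightarrow> u b = 0 \<longrightarrow> u a = 0)" for b
  define b where "b = (GREATEST b. P b)"
  have "P k" using k nonzero zero by (auto simp: P_def)
  moreover have bound: "c \<le> n" if "P c" for c using that by (simp add: P_def)
  ultimately have Pb: "P b" and max: "P c \<Longrightarrow> c \<le> b" for c
    unfolding b_def using GreatestI_nat[of P k n] Greatest_le_nat[of P _ n] by blast+
  have "\<not> P (Suc b)" using max[of "Suc b"] by auto
  have b: "k \<le> b" "b \<le> n" "a \<le> b" using Pb k by (auto simp: P_def)
  obtain u where u: "chain t a b u" "u a \<noteq> 0" using Pb by (auto simp: P_def)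
  have zero_b: "w a = 0" if "chain t a b w" "w b = 0" for w
    using Pb that by (auto simp: P_def)
  consider "b = n" | "b < n" "even b = t" | "b < n" "even b \<noteq> t"
    using b by linarith
  then show ?thesis
  proof cases
    case 1
    then have "end_image t b = {0}" by (simp add: end_image_def)
    then show ?thesis using that b u zero_b 1 by blast
  next
    case 2
    have "zigzag_step t b (u b) (B b (u b))"
      using 2 chain_in_V[OF u(1)] b B_linear(1) by (simp add: zigzag_step_def)
    from chain_extend[OF u(1) b(3) this]
    have "\<exists>u. chain t a (Suc b) u \<and> u a \<noteq> 0"
      using u(2) b(3) by (intro exI[of _ "u(Suc b := B b (u b))"]) auto
    with \<open>\<not> P (Suc b)\<close> obtain w where w: "chain t a (Suc b) w" "w (Suc b) = 0" "w a \<noteq> 0"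
      using b 2 by (auto simp: P_def)
    then have "B b (w b) = 0" using 2 b by (auto simp: chain_def zigzag_step_def)
    moreover have "end_image t b = {0}" using 2 by (simp add: end_image_def)
    ultimately show ?thesis
      using that[of b w] b w chain_restrict zero_b by blast
  next
    case 3
    have "w a = 0" if "chain t a (Suc b) w" "w (Suc b) = 0" for w
    proof (rule zero_b)
      show "chain t a b w" using that(1) by (rule chain_restrict)
      have "zigzag_step t b (w b) (w (Suc b))" using that(1) b by (simp add: chain_def)
      then show "w b = 0" using 3 that(2) A_0 by (auto simp: zigzag_step_def)
    qed
    with \<open>\<not> P (Suc b)\<close> have none: "w a = 0" if "chain t a (Suc b) w" for w
      using that b 3 by (auto simp: P_def)
    have "w a = 0" if w: "chain t a b w" "w b \<in> end_image t b" for w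
    proof -
      obtain y where y: "y \<in> V (Suc b)" "w b = A b y"
        using w(2) 3 by (auto simp: end_image_def)
      then have "zigzag_step t b (w b) y"
        using 3 A_linear(1) by (auto simp: zigzag_step_def)
      then show ?thesis
        using none[OF chain_extend[OF w(1) b(3)]] b(3) by auto
    qed
    then show ?thesis using that[of b u] b u 3 by blast
  qed
qed

text \<open>
  A family of functionals on the spaces \<open>V i\<close> with \<open>a \<le> i \<le> b\<close> is the same as one functional on
  their direct sum. The required identities say that it vanishes on a certain subspace, so it
  remains to see that the vector \<open>u a\<close> in the summand \<open>V a\<close> does not lie in this subspace. If it
  did, then comparing components would give a chain that starts at \<open>u a\<close> and ends in \<open>end_image t b\<close>.
\<close>

lemma exists_compatible_functionals:
  assumes ab: "a \<le> b" "b \<le> n" and u: "chain t a b u" "u a \<noteq> 0"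
    and sep: "\<forall>w. chain t a b w \<longrightarrow> w b \<in> end_image t b \<longrightarrow> w a = 0"
  obtains \<xi> :: "nat \<Rightarrow> 'v \<Rightarrow> 'k"
  where "\<And>i x y. \<xi> i (x + y) = \<xi> i x + \<xi> i y" "\<And>i c x. \<xi> i (scale c x) = c * \<xi> i x"
    "\<And>i x y. a \<le> i \<Longrightarrow> i < b \<Longrightarrow> zigzag_step t i x y \<Longrightarrow> \<xi> i x = \<xi> (Suc i) y"
    "\<And>z. z \<in> end_image t b \<Longrightarrow> \<xi> b z = 0"
    "\<And>i. a \<le> i \<Longrightarrow> i \<le> b \<Longrightarrow> \<xi> i (u i) = 1"
proof -
  define fscale :: "'k \<Rightarrow> (nat \<Rightarrow> 'v) \<Rightarrow> nat \<Rightarrow> 'v" where "fscale c f = (\<lambda>i. scale c (f i))" for c f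
  interpret F: vector_space fscale
    by unfold_locales (auto simp: fscale_def fun_eq_iff scale_right_distrib scale_left_distrib)
  \<comment> \<open>The direct sum is realised inside \<open>nat \<Rightarrow> 'v\<close>, with \<open>\<delta> i\<close> as the inclusion of the
  summand at \<open>i\<close>.\<close>
  define \<delta> :: "nat \<Rightarrow> 'v \<Rightarrow> nat \<Rightarrow> 'v" where "\<delta> i x = (\<lambda>j. if j = i then x else 0)" for i x
  \<comment> \<open>\<open>comb p q z\<close> is the sum of \<open>\<delta> i (p i) - \<delta> (Suc i) (q i)\<close> over \<open>a \<le> i < b\<close>, plus \<open>\<delta> b z\<close>.\<close>
  define comb :: "(nat \<Rightarrow> 'v) \<Rightarrow> (nat \<Rightarrow> 'v) \<Rightarrow> 'v \<Rightarrow> nat \<Rightarrow> 'v" where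
    "comb p q z = (\<lambda>j. (if a \<le> j \<and> j < b then p j else 0)
       - (if a < j \<and> j \<le> b then q (j - 1) else 0) + (if j = b then z else 0))" for p q z
  define steps where "steps p q \<longleftrightarrow> (\<forall>i. a \<le> i \<and> i < b \<longrightarrow> zigzag_step t i (p i) (q i))" for p q
  define T where "T = {comb p q z | p q z. steps p q \<and> z \<in> end_image t b}"
  have T: "comb p q z \<in> T" if "steps p q" "z \<in> end_image t b" for p q z
    using that by (auto simp: T_def)
  note Z = subspace_end_image[OF ab(2), of t]
  have "F.subspace T"
    unfolding F.subspace_def
  proof (intro conjI ballI allI)
    have "steps (\<lambda>_. 0) (\<lambda>_. 0)" using ab by (simp add: steps_def zigzag_step_0)
    moreover have "comb (\<lambda>_. 0) (\<lambda>_. 0) 0 = 0" by (simp add: comb_def fun_eq_iff)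
    ultimately show "0 \<in> T" using T[of "\<lambda>_. 0" "\<lambda>_. 0" 0] subspace_0[OF Z] by simp
  next
    fix d e assume "d \<in> T" "e \<in> T"
    then obtain p q z p' q' z' where d: "d = comb p q z" "steps p q" "z \<in> end_image t b"
      and e: "e = comb p' q' z'" "steps p' q'" "z' \<in> end_image t b"
      by (auto simp: T_def)
    have "d + e = comb (\<lambda>i. p i + p' i) (\<lambda>i. q i + q' i) (z + z')"
      by (auto simp: d e comb_def fun_eq_iff)
    moreover have "steps (\<lambda>i. p i + p' i) (\<lambda>i. q i + q' i)"
      using d e ab by (simp add: steps_def zigzag_step_add)
    ultimately show "d + e \<in> T" using T subspace_add[OF Z d(3) e(3)] by simp
  next
    fix c d assume "d \<in> T"
    then obtain p q z where d: "d = comb p q z" "steps p q" "z \<in> end_image t b"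
      by (auto simp: T_def)
    have "fscale c d = comb (\<lambda>i. scale c (p i)) (\<lambda>i. scale c (q i)) (scale c z)"
      by (auto simp: d fscale_def comb_def fun_eq_iff algebra_simps)
    moreover have "steps (\<lambda>i. scale c (p i)) (\<lambda>i. scale c (q i))"
      using d ab by (simp add: steps_def zigzag_step_scale)
    ultimately show "fscale c d \<in> T" using T subspace_scale[OF Z d(3)] by simp
  qed
  moreover have "\<delta> a (u a) \<notin> T"
  proof
    assume "\<delta> a (u a) \<in> T"
    then obtain p q z where d: "\<delta> a (u a) = comb p q z" "steps p q" "z \<in> end_image t b"
      by (auto simp: T_def)
    \<comment> \<open>At each vertex strictly between \<open>a\<close> and \<open>b\<close> the two contributions cancel, so the steps
    from \<open>p i\<close> to \<open>q i\<close> fit together.\<close>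
    have at: "\<delta> a (u a) j = comb p q z j" for j using d(1) by simp
    define w where "w i = (if i < b then p i else z)" for i
    have w_Suc: "w (Suc i) = q i" if "a \<le> i" "i < b" for i
      using at[of "Suc i"] that by (auto simp: \<delta>_def comb_def w_def)
    have w_a: "w a = u a"
      using at[of a] ab by (auto simp: \<delta>_def comb_def w_def)
    have "chain t a b w"
      using d(2) w_a w_Suc chain_in_V[OF u(1), of a] ab
      by (auto simp: chain_def steps_def w_def)
    moreover have "w b = z" by (simp add: w_def)
    ultimately have "w a = 0" using sep d(3) by simp
    then show False using w_a u(2) by simp
  qed
  ultimately obtain f where f: "Vector_Spaces.linear fscale (*) f" "\<And>d. d \<in> T \<Longrightarrow> f d = 0"
      "f (\<delta> a (u a)) = 1"
    using F.exists_functional_separating by metis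
  interpret f: Vector_Spaces.linear fscale "(*)" f by (fact f(1))
  define \<xi> where "\<xi> i x = f (\<delta> i x)" for i x
  have "\<delta> i (x + y) = \<delta> i x + \<delta> i y" for i x y by (auto simp: \<delta>_def fun_eq_iff)
  then have add: "\<xi> i (x + y) = \<xi> i x + \<xi> i y" for i x y by (simp add: \<xi>_def f.add)
  have "\<delta> i (scale c x) = fscale c (\<delta> i x)" for i c x
    by (auto simp: \<delta>_def fscale_def fun_eq_iff)
  then have scl: "\<xi> i (scale c x) = c * \<xi> i x" for i c x by (simp add: \<xi>_def f.scale)
  have compat: "\<xi> i x = \<xi> (Suc i) y" if i: "a \<le> i" "i < b" and xy: "zigzag_step t i x y" for i x y
  proof -
    have "\<delta> i x - \<delta> (Suc i) y = comb (\<delta> i x) (\<delta> i y) 0"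
      using i by (auto simp: comb_def \<delta>_def fun_eq_iff)
    moreover have "steps (\<delta> i x) (\<delta> i y)"
      using xy ab by (auto simp: steps_def \<delta>_def zigzag_step_0)
    ultimately have "f (\<delta> i x - \<delta> (Suc i) y) = 0"
      using f(2) T subspace_0[OF Z] by metis
    then show ?thesis by (simp add: \<xi>_def f.diff)
  qed
  have zero: "\<xi> b z = 0" if "z \<in> end_image t b" for z
  proof -
    have "\<delta> b z = comb (\<lambda>_. 0) (\<lambda>_. 0) z" by (auto simp: comb_def \<delta>_def fun_eq_iff)
    moreover have "steps (\<lambda>_. 0) (\<lambda>_. 0)" using ab by (simp add: steps_def zigzag_step_0)
    ultimately show ?thesis using f(2) T that by (simp add: \<xi>_def)
  qed
  have one: "\<xi> i (u i) = 1" if "a \<le> i" "i \<le> b" for i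
    using that
  proof (induction i rule: dec_induct)
    case base
    show ?case using f(3) by (simp add: \<xi>_def)
  next
    case (step i)
    have "zigzag_step t i (u i) (u (Suc i))" using u(1) step by (simp add: chain_def)
    then show ?case using compat[of i] step by simp
  qed
  from add scl compat zero one show ?thesis by (rule that)
qed



section \<open>Zigzag strings\<close>

lemma A_B_if_no_loops:
  assumes no_loops: "\<And>i x. i < n \<Longrightarrow> x \<in> V (Suc i) \<Longrightarrow> B i (A i x) = 0"
    and "i < n" "x \<in> V i"
  shows "A i (B i x) = 0"
proof (cases i)
  case 0
  then show ?thesis using assms A_B_0 by simp
next
  case (Suc k)
  then show ?thesis using assms A_B_eq_B_A by simp
qed

text \<open>
  The arrows of the zigzag respect the chain \<open>u\<close> and the functionals by construction; it remains
  to see that all other arrows between its vertices act by zero on them. For an inner vertex this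
  is the vanishing of paths of length two: a vector of \<open>u\<close> at a sink is an image, so every arrow
  kills it, and a functional at a source factors through an arrow, so it kills every image. At
  the ends one needs that \<open>a\<close> is the lowest vertex, and the terminal conditions at \<open>b\<close>. The
  hypotheses \<open>source\<close> and \<open>sink\<close> take care of strings of length zero, where no step of the zigzag
  provides the factorisation.
\<close>

lemma string_module_if_terminal_chain:
  assumes indec: "indecomposable n scale M"
    and no_loops: "\<And>i x. i < n \<Longrightarrow> x \<in> V (Suc i) \<Longrightarrow> B i (A i x) = 0"
    and ab: "a \<le> b" "b \<le> n" and below: "\<And>j. j < a \<Longrightarrow> V j = {0}"
    and source: "\<And>y. even a = t \<Longrightarrow> a < n \<Longrightarrow> y \<in> V (Suc a) \<Longrightarrow> A a y = 0"
    and sink: "even a \<noteq> t \<Longrightarrow> a < b"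
    and u: "chain t a b u" "u a \<noteq> 0" and last: "b < n \<Longrightarrow> even b = t \<Longrightarrow> B b (u b) = 0"
    and sep: "\<forall>w. chain t a b w \<longrightarrow> w b \<in> end_image t b \<longrightarrow> w a = 0"
  shows "rep_isomorphic n scale M coord_scale (string_module (a, zigzag_word t a (b - a)))"
proof -
  obtain \<xi> :: "nat \<Rightarrow> 'v \<Rightarrow> 'k" where
    \<xi>_linear: "\<And>i x y. \<xi> i (x + y) = \<xi> i x + \<xi> i y" "\<And>i c x. \<xi> i (scale c x) = c * \<xi> i x"
    and \<xi>_step: "\<And>i x y. a \<le> i \<Longrightarrow> i < b \<Longrightarrow> zigzag_step t i x y \<Longrightarrow> \<xi> i x = \<xi> (Suc i) y"
    and \<xi>_end: "\<And>z. z \<in> end_image t b \<Longrightarrow> \<xi> b z = 0"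
    and \<xi>_u: "\<And>i. a \<le> i \<Longrightarrow> i \<le> b \<Longrightarrow> \<xi> i (u i) = 1"
    using exists_compatible_functionals[OF ab u sep] by blast
  have \<xi>_0: "\<xi> i 0 = 0" for i using \<xi>_linear(2)[of i 0 0] by simp
  note A_B = A_B_if_no_loops[OF no_loops]
  have u_V: "u i \<in> V i" if "a \<le> i" "i \<le> b" for i using chain_in_V[OF u(1)] that by simp
  have u_step: "zigzag_step t i (u i) (u (Suc i))" if "a \<le> i" "i < b" for i
    using u(1) that by (simp add: chain_def)

  have \<xi>_B: "\<xi> (Suc i) (B i x) = (if i < b \<and> even i = t then \<xi> i x else 0)"
    if i: "a \<le> i" "i < b" and x: "x \<in> V i" for i x
  proof (cases "even i = t")
    case True
    then have st: "zigzag_step t i x (B i x)"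
      using i x ab B_linear(1) by (simp add: zigzag_step_def)
    show ?thesis using \<xi>_step[OF i st] True i by simp
  next
    case False
    then have st: "zigzag_step t i 0 (B i x)"
      using i x ab B_linear(1) A_B V_closed(1)[of i] by (simp add: zigzag_step_def)
    show ?thesis using \<xi>_step[OF i st] \<xi>_0 False i by simp
  qed
  have \<xi>_A: "\<xi> i (A i y) = (if i < b \<and> even i \<noteq> t then \<xi> (Suc i) y else 0)"
    if i: "a \<le> i" "i \<le> b" "i < n" and y: "y \<in> V (Suc i)" for i y
  proof -
    consider "i < b" "even i \<noteq> t" | "i < b" "even i = t" | "i = b" "even i \<noteq> t"
      | "i = b" "even i = t" "i = a" | "i = b" "even i = t" "a < b"
      using i by linarith
    then show ?thesis
    proof cases
      case 1
      then have st: "zigzag_step t i (A i y) y"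
        using i y A_linear(1) by (simp add: zigzag_step_def)
      show ?thesis using \<xi>_step[OF _ _ st] 1 i by simp
    next
      case 2
      then have st: "zigzag_step t i (A i y) 0"
        using i y A_linear(1) no_loops V_closed(1)[of "Suc i"] by (simp add: zigzag_step_def)
      show ?thesis using \<xi>_step[OF _ _ st] \<xi>_0 2 i by simp
    next
      case 3
      then show ?thesis using \<xi>_end i y by (simp add: end_image_def)
    next
      case 4
      then show ?thesis using source i y \<xi>_0 by simp
    next
      case 5
      then obtain k where k: "b = Suc k" by (cases b) auto
      have st: "zigzag_step t k 0 (A i y)"
        using 5 k i y A_linear(1) A_A V_closed(1)[of k] by (auto simp: zigzag_step_def)
      show ?thesis using \<xi>_step[OF _ _ st] \<xi>_0 5 k by simp
    qed
  qed
  have u_B: "B i (u i) = (if i < b \<and> even i = t then u (Suc i) else 0)"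
    if i: "a \<le> i" "i \<le> b" "i < n" for i
  proof -
    consider "i < b" "even i = t" | "i < b" "even i \<noteq> t" | "i = b" "even i = t"
      | "i = b" "even i \<noteq> t"
      using i by linarith
    then show ?thesis
    proof cases
      case 4
      then have "a < b" using sink i by (cases "a = b") auto
      then obtain k where k: "b = Suc k" "a \<le> k" by (cases b) auto
      then have "u b = B k (u k)"
        using u_step[of k] 4 by (auto simp: zigzag_step_def)
      then show ?thesis using 4 k i B_B u_V[of k] by simp
    next
      case 2
      then have "u i = A i (u (Suc i))" using u_step[of i] i by (simp add: zigzag_step_def)
      then show ?thesis using 2 i no_loops u_V[of "Suc i"] by simp
    qed (use u_step[of i] last i in \<open>auto simp: zigzag_step_def\<close>)
  qed
  have u_A: "A i (u (Suc i)) = (if even i \<noteq> t then u i else 0)"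
    if i: "a \<le> i" "i < b" for i
    using u_step[OF i] i ab A_B[of i "u i"] by (auto simp: zigzag_step_def)
  have u_A_first: "A i (u a) = 0" if "a = Suc i" for i
    using A_linear(1)[of i "u a"] u_V[of a] below[of i] that ab by simp

  define \<phi> :: "nat \<Rightarrow> 'v \<Rightarrow> nat \<Rightarrow> 'k" where
    "\<phi> j x h = (if a \<le> j \<and> j \<le> b \<and> a + h = j then \<xi> j x else 0)" for j x h
  define \<sigma> :: "nat \<Rightarrow> (nat \<Rightarrow> 'k) \<Rightarrow> 'v" where
    "\<sigma> j c = (if a \<le> j \<and> j \<le> b then scale (c (j - a)) (u j) else 0)" for j c
  define N :: "(nat \<Rightarrow> 'k) rep" where "N = string_module (a, zigzag_word t a (b - a))"
  have N: "rep_space N j = coord_space {h. h \<le> b - a \<and> a + h = j}"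
    "rep_map N (Beta i) c h =
      (if 1 \<le> h \<and> h \<le> b - a \<and> a + h = Suc i \<and> even i = t then c (h - 1) else 0)"
    "rep_map N (Alpha i) c h = (if h < b - a \<and> a + h = i \<and> even i \<noteq> t then c (Suc h) else 0)"
    for i j c h
    unfolding N_def by (rule zigzag_module_space zigzag_module_map)+
  show ?thesis
    unfolding N_def[symmetric]
  proof (rule indecomposable_iso_retract[OF B_module indec vector_space_coord_scale])
    show "module.subspace coord_scale (rep_space N j)" for j
      by (simp add: N subspace_coord_space)
    show "rep_hom n scale M coord_scale N \<phi>"
    proof (rule rep_homI)
      fix i x assume i: "i < n" and x: "x \<in> V (Suc i)"
      have "\<phi> i (A i x) h = rep_map N (Alpha i) (\<phi> (Suc i) x) h" for h
        using \<xi>_A[of i x] i x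
        by (auto simp: N \<phi>_def)
      then show "\<phi> i (A i x) = rep_map N (Alpha i) (\<phi> (Suc i) x)" ..
    next
      fix i x assume i: "i < n" and x: "x \<in> V i"
      have "\<phi> (Suc i) (B i x) h = rep_map N (Beta i) (\<phi> i x) h" for h
      proof (cases "Suc i = a")
        case True
        then have "B i x = 0" using below[of i] x B_0[OF i] by simp
        then show ?thesis using True \<xi>_0 by (auto simp: N \<phi>_def)
      next
        case False
        then show ?thesis
          using \<xi>_B[of i x] i x
          by (auto simp: N \<phi>_def)
      qed
      then show "\<phi> (Suc i) (B i x) = rep_map N (Beta i) (\<phi> i x)" ..
    qed (auto simp: N \<phi>_def coord_space_def coord_scale_def fun_eq_iff \<xi>_linear)
    show "rep_hom n coord_scale N scale M \<sigma>"
    proof (rule rep_homI)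
      fix i c assume i: "i < n" and c: "c \<in> rep_space N (Suc i)"
      consider "Suc i < a" | "Suc i = a" | "a \<le> i" "i < b" | "b \<le> i" by linarith
      then show "\<sigma> i (rep_map N (Alpha i) c) = A i (\<sigma> (Suc i) c)"
      proof cases
        case 3
        then show ?thesis using i u_A[of i] u_V[of "Suc i"]
          by (auto simp: N \<sigma>_def A_linear Suc_diff_le)
      qed (use i ab u_A_first[of i] u_V[of a] A_0 in
        \<open>auto simp: N \<sigma>_def A_linear\<close>)
    next
      fix i c assume i: "i < n" and c: "c \<in> rep_space N i"
      consider "i < a" | "a \<le> i" "i \<le> b" | "b < i" by linarith
      then show "\<sigma> (Suc i) (rep_map N (Beta i) c) = B i (\<sigma> i c)"
      proof cases
        case 2
        then show ?thesis using i u_B[of i] u_V[of i]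
          by (auto simp: N \<sigma>_def B_linear Suc_diff_le)
      qed (use i ab B_0 in \<open>auto simp: N \<sigma>_def\<close>)
    qed (use u_V in \<open>auto simp: \<sigma>_def coord_scale_def V_closed scale_left_distrib\<close>)
    show "\<phi> j (\<sigma> j y) = y" if y: "y \<in> rep_space N j" for j y
    proof
      fix h
      show "\<phi> j (\<sigma> j y) h = y h"
      proof (cases "h \<le> b - a \<and> a + h = j")
        case True
        then show ?thesis using \<xi>_u[of j] ab by (auto simp: \<phi>_def \<sigma>_def \<xi>_linear)
      next
        case False
        then have "y h = 0" using y unfolding N coord_space_def by blast
        moreover have "\<not> (a \<le> j \<and> j \<le> b \<and> a + h = j)" using False by linarith
        ultimately show ?thesis by (simp only: \<phi>_def if_False)
      qed
    qed
    show "a \<le> n" using ab by simp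
    show "(\<lambda>h. if h = 0 then 1 else 0) \<in> rep_space N a"
      by (simp add: N coord_space_def)
    show "(\<lambda>h::nat. if h = 0 then 1 else 0) \<noteq> (0 :: nat \<Rightarrow> 'k)"
      by (auto simp: fun_eq_iff)
  qed
qed

text \<open>
  The type of the zigzag is decided at its lowest vertex \<open>a\<close>. If \<open>\<alpha>\<^sub>a\<close> is not zero, then \<open>a\<close> is
  taken as a sink and the search for the end starts at \<open>a + 1\<close>; otherwise \<open>a\<close> is taken as a source
  and the search starts at \<open>a\<close>.
\<close>

lemma string_module_if_no_loops:
  assumes indec: "indecomposable n scale M"
    and no_loops: "\<And>i x. i < n \<Longrightarrow> x \<in> V (Suc i) \<Longrightarrow> B i (A i x) = 0"
  shows "\<exists>w. is_string n w \<and> rep_isomorphic n scale M coord_scale (string_module w)"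
proof -
  define a where "a = (LEAST j. j \<le> n \<and> V j \<noteq> {0})"
  obtain j where "j \<le> n \<and> V j \<noteq> {0}" using indec by (auto simp: indecomposable_def)
  then have a: "a \<le> n" "V a \<noteq> {0}"
    unfolding a_def using LeastI[of "\<lambda>j. j \<le> n \<and> V j \<noteq> {0}"] by auto
  have below: "V j = {0}" if "j < a" for j
    using not_less_Least[of j "\<lambda>j. j \<le> n \<and> V j \<noteq> {0}"] that a(1) by (auto simp: a_def)
  obtain x where x: "x \<in> V a" "x \<noteq> 0" using a V_closed(1)[of a] by blast
  have "\<exists>t k u\<^sub>0. a \<le> k \<and> k \<le> n \<and> chain t a k u\<^sub>0 \<and> u\<^sub>0 a \<noteq> 0 \<and>
      (\<forall>u. chain t a k u \<longrightarrow> u k = 0 \<longrightarrow> u a = 0) \<and>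
      (even a = t \<longrightarrow> a < n \<longrightarrow> (\<forall>y \<in> V (Suc a). A a y = 0)) \<and> (even a \<noteq> t \<longrightarrow> a < k)"
  proof (cases "\<exists>y. a < n \<and> y \<in> V (Suc a) \<and> A a y \<noteq> 0")
    case True
    then obtain y where y: "a < n" "y \<in> V (Suc a)" "A a y \<noteq> 0" by blast
    have "chain (odd a) a (Suc a) ((\<lambda>_. y)(a := A a y))"
      using y A_linear(1) by (auto simp: chain_def zigzag_step_def less_Suc_eq_le)
    moreover have "u a = 0" if "chain (odd a) a (Suc a) u" "u (Suc a) = 0" for u
      using that A_0 y(1) by (auto simp: chain_def zigzag_step_def)
    ultimately show ?thesis
      using y by (intro exI[of _ "odd a"] exI[of _ "Suc a"] exI[of _ "(\<lambda>_. y)(a := A a y)"]) auto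
  next
    case False
    have "chain (even a) a a (\<lambda>_. x)" using x by (auto simp: chain_def)
    then show ?thesis
      using False a x by (intro exI[of _ "even a"] exI[of _ a] exI[of _ "\<lambda>_. x"]) auto
  qed
  then obtain t k u\<^sub>0 where k: "a \<le> k" "k \<le> n" and u\<^sub>0: "chain t a k u\<^sub>0" "u\<^sub>0 a \<noteq> 0"
    and zero: "\<forall>u. chain t a k u \<longrightarrow> u k = 0 \<longrightarrow> u a = 0"
    and source: "\<And>y. even a = t \<Longrightarrow> a < n \<Longrightarrow> y \<in> V (Suc a) \<Longrightarrow> A a y = 0"
    and sink: "even a \<noteq> t \<Longrightarrow> a < k"
    by blast
  obtain b u where b: "k \<le> b" "b \<le> n" and u: "chain t a b u" "u a \<noteq> 0"
    and last: "b < n \<Longrightarrow> even b = t \<Longrightarrow> B b (u b) = 0"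
    and sep: "\<And>w. chain t a b w \<Longrightarrow> w b \<in> end_image t b \<Longrightarrow> w a = 0"
    using exists_terminal_chain[OF k u\<^sub>0 zero] by blast
  have "rep_isomorphic n scale M coord_scale (string_module (a, zigzag_word t a (b - a)))"
    using k(1) b sink
    by (intro string_module_if_terminal_chain[OF indec no_loops _ b(2) below source _ u last])
      (auto intro: sep)
  moreover have "is_string n (a, zigzag_word t a (b - a))"
    using k(1) b by (intro is_string_zigzag_word) simp
  ultimately show ?thesis by blast
qed

end

theorem theorem4p4:
  fixes n :: nat
    and scale :: "'k::alg_closed_field \<Rightarrow> 'v::ab_group_add \<Rightarrow> 'v"
    and M :: "'v rep"
  assumes "n \<ge> 1"
    and "B_module n scale M"
    and "indecomposable n scale M"
  shows "(\<exists>i. i + 2 \<le> n \<and> rep_isomorphic n scale M coord_scale (R_module i)) \<or>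
         (\<exists>w. is_string n w \<and> rep_isomorphic n scale M coord_scale (string_module w))"
proof -
  interpret B_mod n scale M by unfold_locales (fact assms(2))
  show ?thesis
  proof (cases "\<exists>i x. i < n \<and> x \<in> V (Suc i) \<and> B i (A i x) \<noteq> 0")
    case True
    then obtain i x where i: "i < n" and x: "x \<in> V (Suc i)" "B i (A i x) \<noteq> 0" by blast
    show ?thesis
    proof (cases "Suc i < n")
      case True
      then show ?thesis using R_module_if_inner_loop[OF assms(3) True x] by auto
    next
      case False
      then have n: "n = Suc i" using i by simp
      then have "rep_isomorphic n scale M coord_scale
          (string_module (n, [Arr (Alpha i), Arr (Beta i)]))"
        using x by (intro string_module_if_outer_loop[OF assms(3)]) simp_all
      moreover have "is_string n (n, [Arr (Alpha i), Arr (Beta i)])"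
        unfolding n by (rule is_string_outer_loop)
      ultimately show ?thesis by blast
    qed
  next
    case False
    then show ?thesis using string_module_if_no_loops[OF assms(3)] by blast
  qed
qed

end
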